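(* Let $\mathrm{R}_3=\{a_0,a_1,a_2\}$ be the dihedral quandle of order 3, and put $e_1=a_1-a_0$, $e_2=a_2-a_0$ in $\mathbb{Z}[\mathrm{R}_3]$. For each natural number $k\geq 1$: $\Delta^{2k-1}(\mathrm{R}_3)=\langle 3^{k-1}e_1,\,3^{k-1}e_2\rangle$, $\Delta^{2k}(\mathrm{R}_3)=\langle 3^{k-1}(e_1+e_2),\,3^k e_2\rangle$, and $\Delta^k(\mathrm{R}_3)/\Delta^{k+1}(\mathrm{R}_3)\cong\mathbb{Z}_3$ (as abelian groups), where $\langle\cdot\rangle$ denotes the generated additive subgroup.
   Context: The dihedral quandle $\mathrm{R}_n=\{a_0,\dots,a_{n-1}\}$ has operation $a_i.a_j=a_{2j-i}$, indices modulo $n$. $\mathbb{Z}[\mathrm{R}_n]$ is the free abelian group on $\mathrm{R}_n$ with the bilinear extension of this operation as (non-associative) multiplication. $\Delta(\mathrm{R}_n)$ is the kernel of the augmentation map $\mathbb{Z}[\mathrm{R}_n]\to\mathbb{Z}$, $\sum_i\alpha_i a_i\mapsto\sum_i\alpha_i$. Powers: $\Delta^1=\Delta$, and for $k\ge2$, $\Delta^k$ is the additive subgroup generated by all products $u.v$ with $u\in\Delta^i$, $v\in\Delta^j$, $i,j\geq1$, $i+j=k$. $\mathbb{Z}_m=\mathbb{Z}/m\mathbb{Z}$. *)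

theory Defs
  imports "HOL-Algebra.Free_Abelian_Groups" "HOL-Algebra.Generated_Groups"
begin

(* The element a_i of R_n is represented by the residue of i in {0..<int n}. *)

definition dihedral_carrier :: "nat \<Rightarrow> int set" where
  "dihedral_carrier n = {0..<int n}"

definition dihedral_op :: "nat \<Rightarrow> int \<Rightarrow> int \<Rightarrow> int" where
  "dihedral_op n i j = (2 * j - i) mod int n"

abbreviation ZR :: "nat \<Rightarrow> (int \<Rightarrow>\<^sub>0 int) monoid" where
  "ZR n \<equiv> free_Abelian_group (dihedral_carrier n)"

(* The quandle ring product. It is unrelated to the library product * on
   int \<Rightarrow>\<^sub>0 int, which is convolution with respect to addition of the indices. *)

definition quandle_ring_mult ::
    "('a \<Rightarrow> 'a \<Rightarrow> 'a) \<Rightarrow> ('a \<Rightarrow>\<^sub>0 int) \<Rightarrow> ('a \<Rightarrow>\<^sub>0 int) \<Rightarrow> ('a \<Rightarrow>\<^sub>0 int)" where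
  "quandle_ring_mult f u v = frag_extend (\<lambda>i. frag_extend (\<lambda>j. frag_of (f i j)) v) u"

abbreviation ZR_mult :: "nat \<Rightarrow> (int \<Rightarrow>\<^sub>0 int) \<Rightarrow> (int \<Rightarrow>\<^sub>0 int) \<Rightarrow> (int \<Rightarrow>\<^sub>0 int)" where
  "ZR_mult n \<equiv> quandle_ring_mult (dihedral_op n)"

definition augmentation :: "('a \<Rightarrow>\<^sub>0 int) \<Rightarrow> int" where
  "augmentation u = (\<Sum>i \<in> Poly_Mapping.keys u. Poly_Mapping.lookup u i)"

definition Delta :: "nat \<Rightarrow> (int \<Rightarrow>\<^sub>0 int) set" where
  "Delta n = kernel (ZR n) integer_group augmentation"

(* Delta_pow n k is Delta^k for k \<ge> 1; the value at k = 0 is a dummy that is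
   never used by the recursion, whose indices i and k - i are both positive. *)

fun Delta_pow :: "nat \<Rightarrow> nat \<Rightarrow> (int \<Rightarrow>\<^sub>0 int) set" where
  "Delta_pow n k =
     (if k = 0 then {}
      else if k = 1 then Delta n
      else generate (ZR n)
             (\<Union>i \<in> {1..<k}. \<Union>u \<in> Delta_pow n i. \<Union>v \<in> Delta_pow n (k - i). {ZR_mult n u v}))"

declare Delta_pow.simps [simp del]

definition e :: "nat \<Rightarrow> int \<Rightarrow> (int \<Rightarrow>\<^sub>0 int)" where
  "e n i = frag_of (i mod int n) - frag_of 0"

end

(* In the coordinates x, d of u = x (e1 + e2) - d e2, the power Delta^k consists of the elements with
   3^((k-1) div 2) dvd x and 3^(k div 2) dvd d. Products respect these divisibilities, and left
   multiplication by e1 sends (x, d) to (d, 3x), so it maps the lattice for k onto the one for k + 1.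
   From k to k + 1 exactly one of the two exponents grows, by one, and the quotient is Z_3. *)

theory Submission
  imports Defs
begin

section \<open>Two-generator subgroups and finite cyclic quotients\<close>

lemma generate_free_Abelian_pair:
  assumes "P \<in> carrier (free_Abelian_group S)" "Q \<in> carrier (free_Abelian_group S)"
  shows "generate (free_Abelian_group S) {P, Q} = {frag_cmul a P + frag_cmul b Q | a b. True}"
    (is "generate ?G _ = ?R")
proof
  interpret G: group ?G by simp
  let ?H = "generate ?G {P, Q}"
  have sub: "subgroup ?H ?G"
    using assms by (intro G.generate_is_subgroup) auto
  \<comment> \<open>Integer multiples are the group's integer powers, under which every subgroup is
    closed.\<close>
  have pow: "frag_cmul a X \<in> ?H" if "X \<in> {P, Q}" for a X
  proof -
    have "X [^]\<^bsub>?G\<^esub> a \<in> ?H"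
      using that by (intro G.subgroup_int_pow_closed[OF sub] generate.incl)
    moreover have "Poly_Mapping.keys X \<subseteq> S"
      using that assms by auto
    ultimately show ?thesis by simp
  qed
  then show "?R \<subseteq> ?H"
    using generate.eng[of _ ?G "{P, Q}"] by fastforce
  show "?H \<subseteq> ?R"
  proof
    fix u assume "u \<in> ?H"
    then show "u \<in> ?R"
    proof induction
      case one
      have "\<one>\<^bsub>?G\<^esub> = frag_cmul 0 P + frag_cmul 0 Q" by simp
      then show ?case by blast
    next
      case (incl h)
      have "P = frag_cmul 1 P + frag_cmul 0 Q" "Q = frag_cmul 0 P + frag_cmul 1 Q" by simp_all
      with incl show ?case by blast
    next
      case (inv h)
      have "inv\<^bsub>?G\<^esub> h = - h"
        using inv assms by auto
      then have "inv\<^bsub>?G\<^esub> h = frag_cmul (-1) P + frag_cmul 0 Q \<or>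
          inv\<^bsub>?G\<^esub> h = frag_cmul 0 P + frag_cmul (-1) Q"
        using inv by auto
      then show ?case by blast
    next
      case (eng u v)
      then obtain a b c d where "u = frag_cmul a P + frag_cmul b Q" "v = frag_cmul c P + frag_cmul d Q"
        by blast
      then have "u + v = frag_cmul (a + c) P + frag_cmul (b + d) Q"
        by (simp add: frag_cmul_distrib)
      then show ?case by auto
    qed
  qed
qed

text \<open>First isomorphism theorem for the map that divides \<open>f\<close> by \<open>m\<close>
  and reduces modulo \<open>n\<close>. It is meant for a coordinate \<open>f\<close> whose modulus
  grows from \<open>m\<close> to \<open>m * int n\<close>.\<close>

lemma FactGroup_iso_integer_mod_group:
  assumes "group G" and f: "f \<in> hom G integer_group" and im: "f ` carrier G = {x. m dvd x}"
    and m: "m \<noteq> 0" and n: "n > 0" and N: "N = {x \<in> carrier G. m * int n dvd f x}"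
  shows "G Mod N \<cong> integer_mod_group n"
proof -
  define h where "h = (\<lambda>x. (f x div m) mod int n)"
  have dvd: "m dvd f x" if "x \<in> carrier G" for x
    using im that by auto
  have "h \<in> hom G (integer_mod_group n)"
  proof (rule homI)
    fix x y assume "x \<in> carrier G" "y \<in> carrier G"
    then show "h (x \<otimes>\<^bsub>G\<^esub> y) = h x \<otimes>\<^bsub>integer_mod_group n\<^esub> h y"
      using hom_mult[OF f, of x y] dvd[of x] dvd[of y]
      by (simp add: h_def div_plus_div_distrib_dvd_left mod_add_eq)
  qed (use n in \<open>auto simp: h_def carrier_integer_mod_group\<close>)
  then have "group_hom G (integer_mod_group n) h"
    using \<open>group G\<close> by (simp add: group_hom_def group_hom_axioms_def)
  moreover have "h ` carrier G = carrier (integer_mod_group n)"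
  proof (intro equalityI subsetI)
    fix r assume r: "r \<in> carrier (integer_mod_group n)"
    \<comment> \<open>Any preimage of \<open>m * r\<close> works: dividing by \<open>m\<close>
      returns \<open>r\<close>, which is already reduced modulo \<open>n\<close>.\<close>
    have "m * r \<in> f ` carrier G"
      unfolding im by simp
    then obtain x where "x \<in> carrier G" "f x = m * r" by auto
    moreover have "h x = r"
      using r m n \<open>f x = m * r\<close> by (simp add: h_def carrier_integer_mod_group)
    ultimately show "r \<in> h ` carrier G" by blast
  qed (use n in \<open>auto simp: h_def carrier_integer_mod_group\<close>)
  ultimately have "G Mod kernel G (integer_mod_group n) h \<cong> integer_mod_group n"
    by (rule group_hom.FactGroup_iso)
  moreover have "m * int n dvd f x \<longleftrightarrow> h x = 0" if "x \<in> carrier G" for x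
    using dvd[OF that] m by (auto simp: h_def mod_eq_0_iff_dvd elim!: dvdE)
  then have "kernel G (integer_mod_group n) h = N"
    by (auto simp: N kernel_def)
  ultimately show ?thesis by simp
qed

section \<open>Coordinates on the augmentation ideal and the product in them\<close>

definition tri :: "int \<Rightarrow> int \<Rightarrow> (int \<Rightarrow>\<^sub>0 int)" where
  "tri x d = frag_cmul x (e 3 1 + e 3 2) - frag_cmul d (e 3 2)"

text \<open>The coordinate \<open>x\<close> is the coefficient of a_1, and \<open>d\<close> is that
  coefficient minus the one of a_2. Identities between such elements can thus be checked coefficient
  by coefficient.\<close>

lemma lookup_tri:
  "Poly_Mapping.lookup (tri x d) i =
     (if i = 0 then d - 2 * x else if i = 1 then x else if i = 2 then x - d else 0)"
  unfolding tri_def e_def lookup_add lookup_minus lookup_frag_cmul lookup_frag_of by simp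

lemma keys_tri: "Poly_Mapping.keys (tri x d) \<subseteq> {0..<3}"
  by (auto simp: in_keys_iff lookup_tri split: if_splits)

lemma carrier_tri: "tri x d \<in> carrier (ZR 3)"
  using keys_tri by (simp add: dihedral_carrier_def)

lemma tri_add: "tri x d + tri x' d' = tri (x + x') (d + d')"
  by (rule poly_mapping_eqI) (simp add: lookup_tri lookup_add)

lemma tri_minus: "- tri x d = tri (- x) (- d)"
  by (rule poly_mapping_eqI) (simp add: lookup_tri)

lemma tri_cmul: "frag_cmul c (tri x d) = tri (c * x) (c * d)"
  by (rule poly_mapping_eqI) (simp add: lookup_tri algebra_simps)

lemma e_tri: "e 3 1 = tri 1 1" "e 3 2 = tri 0 (-1)" "e 3 1 + e 3 2 = tri 1 0"
  by (auto intro!: poly_mapping_eqI simp: tri_def)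

text \<open>Bilinearity reduces this to products of basis elements. The point of the grouping is
  that \<open>2 * (d * d')\<close> in the first coordinate is the only term without a factor
  3.\<close>

lemma tri_mult:
  "ZR_mult 3 (tri x d) (tri x' d') =
     tri (3 * (x * d' + d * x' - x * x') - 2 * (d * d')) (3 * (x * d' + d * x' - d * d'))"
  unfolding quandle_ring_mult_def tri_def e_def frag_extend_diff frag_extend_add
    frag_extend_cmul frag_extend_of dihedral_op_def
  by (rule poly_mapping_eqI,
      simp only: lookup_add lookup_minus lookup_frag_cmul lookup_frag_of, simp add: algebra_simps)

text \<open>When the three coefficients sum to zero, those of a_1 and a_2 determine the element, and
  they can be arbitrary.\<close>

lemma Delta_3: "Delta 3 = {tri x d | x d. True}"
proof (intro equalityI subsetI)
  fix u assume "u \<in> Delta 3"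
  then have keys: "Poly_Mapping.keys u \<subseteq> {0..<3}" and "augmentation u = 0"
    by (auto simp: Delta_def kernel_def dihedral_carrier_def)
  moreover have "augmentation u = (\<Sum>i\<in>{0..<3}. Poly_Mapping.lookup u i)"
    unfolding augmentation_def
    \<comment> \<open>Indices outside the support contribute zero, so the sum may run over all
      three.\<close>
    using keys by (intro sum.mono_neutral_left) (auto simp: in_keys_iff)
  moreover have *: "{0..<3} = {0, 1, 2 :: int}" by auto
  ultimately have sum0: "Poly_Mapping.lookup u 0 + Poly_Mapping.lookup u 1 + Poly_Mapping.lookup u 2 = 0"
    by simp
  have "Poly_Mapping.lookup u i = 0" if "i \<notin> {0, 1, 2}" for i
    using keys that unfolding * by (meson in_keys_iff subsetD)
  then have "u = tri (Poly_Mapping.lookup u 1) (Poly_Mapping.lookup u 1 - Poly_Mapping.lookup u 2)"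
    using sum0 by (intro poly_mapping_eqI) (auto simp: lookup_tri)
  then show "u \<in> {tri x d | x d. True}" by blast
next
  fix u assume "u \<in> {tri x d | x d. True}"
  then obtain x d where u: "u = tri x d" by blast
  have "augmentation u = (\<Sum>i\<in>{0..<3}. Poly_Mapping.lookup u i)"
    unfolding augmentation_def u
    using keys_tri by (intro sum.mono_neutral_left) (auto simp: in_keys_iff)
  also have "{0..<3} = {0, 1, 2 :: int}" by auto
  finally have "augmentation u = 0"
    by (simp add: u lookup_tri)
  then show "u \<in> Delta 3"
    using carrier_tri[of x d] by (simp add: Delta_def kernel_def u)
qed

section \<open>Sublattices cut out by divisibility of the coordinates, and their generators\<close>

definition tri_lattice :: "int \<Rightarrow> int \<Rightarrow> (int \<Rightarrow>\<^sub>0 int) set" where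
  "tri_lattice m n = {tri x d | x d. m dvd x \<and> n dvd d}"

text \<open>The coordinates are unique, since the coefficients of a_1 and a_2 recover them.\<close>

lemma tri_in_lattice [simp]: "tri x d \<in> tri_lattice m n \<longleftrightarrow> m dvd x \<and> n dvd d"
proof -
  have "x = x' \<and> d = d'" if "tri x d = tri x' d'" for x' d'
    using arg_cong[OF that, of "\<lambda>u. Poly_Mapping.lookup u 1"]
      arg_cong[OF that, of "\<lambda>u. Poly_Mapping.lookup u 2"]
    by (simp add: lookup_tri)
  then show ?thesis unfolding tri_lattice_def by blast
qed

lemma tri_latticeE:
  assumes "u \<in> tri_lattice m n"
  obtains x d where "u = tri x d" "m dvd x" "n dvd d"
  using assms by (auto simp: tri_lattice_def)

lemma subgroup_tri_lattice: "subgroup (tri_lattice m n) (ZR 3)"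
proof
  show "tri_lattice m n \<subseteq> carrier (ZR 3)"
    using carrier_tri by (auto elim!: tri_latticeE simp del: carrier_free_Abelian_group_iff)
  have "tri 0 0 = 0" by (simp add: tri_def)
  then show "\<one>\<^bsub>ZR 3\<^esub> \<in> tri_lattice m n"
    using tri_in_lattice[of 0 0 m n] by simp
  fix u v assume "u \<in> tri_lattice m n" "v \<in> tri_lattice m n"
  then show "u \<otimes>\<^bsub>ZR 3\<^esub> v \<in> tri_lattice m n"
    by (auto elim!: tri_latticeE simp: tri_add)
next
  fix u assume "u \<in> tri_lattice m n"
  then show "inv\<^bsub>ZR 3\<^esub> u \<in> tri_lattice m n"
    using keys_tri by (auto elim!: tri_latticeE simp: tri_minus dihedral_carrier_def)
qed

lemma tri_lattice_generate_even:
  "tri_lattice m n = generate (ZR 3) {frag_cmul m (e 3 1 + e 3 2), frag_cmul n (e 3 2)}"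
proof -
  \<comment> \<open>The sign comes from \<open>e 3 2 = tri 0 (-1)\<close>.\<close>
  have "tri_lattice m n = {tri (a * m) (- (b * n)) | a b. True}"
  proof (intro equalityI subsetI)
    fix u assume "u \<in> tri_lattice m n"
    then obtain a c where "u = tri (a * m) (c * n)"
      by (metis tri_latticeE dvdE mult.commute)
    then have "u = tri (a * m) (- (- c * n))" by simp
    then show "u \<in> {tri (a * m) (- (b * n)) | a b. True}" by blast
  qed auto
  then show ?thesis
    by (simp add: e_tri tri_cmul generate_free_Abelian_pair[OF carrier_tri carrier_tri] tri_add
        del: minus_frag_cmul)
qed

text \<open>With equal moduli, passing from coefficients (a, b) to coordinates (a, a - b) is an
  invertible integral change of basis.\<close>

lemma tri_lattice_generate_odd:
  "tri_lattice m m = generate (ZR 3) {frag_cmul m (e 3 1), frag_cmul m (e 3 2)}"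
proof -
  have "tri_lattice m m = {tri (a * m) (a * m - b * m) | a b. True}"
  proof (intro equalityI subsetI)
    fix u assume "u \<in> tri_lattice m m"
    then obtain a c where "u = tri (a * m) (c * m)"
      by (metis tri_latticeE dvdE mult.commute)
    then have "u = tri (a * m) (a * m - (a - c) * m)" by (simp add: algebra_simps)
    then show "u \<in> {tri (a * m) (a * m - b * m) | a b. True}" by blast
  qed auto
  then show ?thesis
    by (simp add: e_tri tri_cmul generate_free_Abelian_pair[OF carrier_tri carrier_tri] tri_add)
qed

section \<open>The powers of the augmentation ideal and their successive quotients\<close>

abbreviation Delta_lattice :: "nat \<Rightarrow> (int \<Rightarrow>\<^sub>0 int) set" where
  "Delta_lattice k \<equiv> tri_lattice (3 ^ ((k - 1) div 2)) (3 ^ (k div 2))"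

text \<open>The exponents of 3 are counted term by term in \<open>tri_mult\<close>. It matters that
  \<open>x * x'\<close> is absent from the second coordinate: for even \<open>i\<close> and
  \<open>j\<close> its guaranteed exponent would be one too small.\<close>

lemma Delta_lattice_mult:
  assumes "i \<ge> 1" "j \<ge> 1" "u \<in> Delta_lattice i" "v \<in> Delta_lattice j"
  shows "ZR_mult 3 u v \<in> Delta_lattice (i + j)"
proof -
  obtain x d where u: "u = tri x d" and x: "3 ^ ((i - 1) div 2) dvd x" and d: "3 ^ (i div 2) dvd d"
    using assms(3) by (rule tri_latticeE)
  obtain x' d' where v: "v = tri x' d'" and x': "3 ^ ((j - 1) div 2) dvd x'" and d': "3 ^ (j div 2) dvd d'"
    using assms(4) by (rule tri_latticeE)
  have dvd: "3 ^ c dvd y * z" if "3 ^ a dvd y" "3 ^ b dvd z" "c \<le> a + b" for a b c and y z :: int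
    using mult_dvd_mono[OF that(1,2)] le_imp_power_dvd[OF that(3), of 3]
    by (metis dvd_trans power_add)
  have dvd3: "3 ^ c dvd 3 * (y * z)" if "3 ^ a dvd y" "3 ^ b dvd z" "c \<le> Suc (a + b)"
    for a b c and y z :: int
    using dvd[of "Suc a" "3 * y" b z c] that by (simp add: mult.assoc)
  have xd: "3 ^ ((i + j) div 2) dvd 3 * (x * d')" "3 ^ ((i + j) div 2) dvd 3 * (d * x')"
    "3 ^ ((i + j) div 2) dvd 3 * (d * d')"
    by (rule dvd3[OF x d'] dvd3[OF d x'] dvd3[OF d d'], use assms(1,2) in linarith)+
  have le: "(i + j - 1) div 2 \<le> (i + j) div 2" by linarith
  \<comment> \<open>These two terms occur only in the first coordinate, where the weaker exponent
    suffices.\<close>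
  have "3 ^ ((i + j - 1) div 2) dvd 3 * (x * x')" "3 ^ ((i + j - 1) div 2) dvd d * d'"
    by (rule dvd3[OF x x'] dvd[OF d d'], use assms(1,2) in linarith)+
  moreover have "3 ^ ((i + j - 1) div 2) dvd 3 * (x * d')" "3 ^ ((i + j - 1) div 2) dvd 3 * (d * x')"
    using xd(1,2) le_imp_power_dvd[OF le, of 3] dvd_trans by blast+
  ultimately show ?thesis
    unfolding u v tri_mult tri_in_lattice using xd
    by (simp add: distrib_left right_diff_distrib)
qed

lemma Delta_lattice_Suc:
  assumes "k \<ge> 1" "w \<in> Delta_lattice (Suc k)"
  shows "\<exists>v \<in> Delta_lattice k. w = ZR_mult 3 (e 3 1) v"
proof -
  \<comment> \<open>This needs \<open>k \<ge> 1\<close>. The extra factor 3 in \<open>d\<close> is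
    what can be divided out to give \<open>c\<close> below.\<close>
  have *: "Suc k div 2 = Suc ((k - 1) div 2)" using assms(1) by linarith
  obtain x d where w: "w = tri x d" "3 ^ (k div 2) dvd x" "3 * 3 ^ ((k - 1) div 2) dvd d"
    using assms(2) by (auto simp: * elim!: tri_latticeE)
  then obtain c where "d = 3 * c" "3 ^ ((k - 1) div 2) dvd c"
    by (auto elim!: dvdE)
  moreover have "w = ZR_mult 3 (e 3 1) (tri c x)"
    using w \<open>d = 3 * c\<close> by (simp add: e_tri tri_mult algebra_simps)
  moreover have "tri c x \<in> Delta_lattice k"
    using w \<open>3 ^ ((k - 1) div 2) dvd c\<close> by simp
  ultimately show ?thesis by blast
qed

text \<open>For \<open>k > 1\<close> the set of products is already the whole lattice, since single
  products with left factor \<open>e 3 1\<close> exhaust it. Generating a subgroup therefore adds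
  nothing.\<close>

lemma Delta_pow_3: "k \<ge> 1 \<Longrightarrow> Delta_pow 3 k = Delta_lattice k"
proof (induction k rule: less_induct)
  case (less k)
  interpret G: group "ZR 3" by simp
  show ?case
  proof (cases "k = 1")
    case True
    then show ?thesis
      by (simp add: Delta_pow.simps Delta_3 tri_lattice_def)
  next
    case False
    let ?P = "\<Union>i \<in> {1..<k}. \<Union>u \<in> Delta_pow 3 i. \<Union>v \<in> Delta_pow 3 (k - i). {ZR_mult 3 u v}"
    have P: "?P \<subseteq> Delta_lattice k"
    proof clarify
      fix i u v assume "i \<in> {1..<k}" "u \<in> Delta_pow 3 i" "v \<in> Delta_pow 3 (k - i)"
      then show "ZR_mult 3 u v \<in> Delta_lattice k"
        using Delta_lattice_mult[of i "k - i" u v] less.IH[of i] less.IH[of "k - i"] by auto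
    qed
    have "Delta_lattice k \<subseteq> ?P"
    proof
      fix w assume "w \<in> Delta_lattice k"
      moreover have "k - 1 \<ge> 1" "Suc (k - 1) = k"
        using less.prems False by linarith+
      ultimately obtain v where "v \<in> Delta_lattice (k - 1)" "w = ZR_mult 3 (e 3 1) v"
        using Delta_lattice_Suc[of "k - 1" w] by metis
      moreover have "e 3 1 \<in> Delta_pow 3 1"
        using less.IH[of 1] less.prems False by (simp add: e_tri)
      moreover have "Delta_pow 3 (k - 1) = Delta_lattice (k - 1)"
        using less.IH[of "k - 1"] less.prems False by simp
      moreover have "1 \<in> {1..<k}"
        using less.prems False by simp
      ultimately show "w \<in> ?P" by blast
    qed
    with P have "?P = Delta_lattice k" by blast
    moreover have "Delta_pow 3 k = generate (ZR 3) ?P"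
      using less.prems False by (subst Delta_pow.simps) simp
    moreover have "generate (ZR 3) (Delta_lattice k) = Delta_lattice k"
      using G.generateI[OF subgroup_tri_lattice subset_refl] by blast
    ultimately show ?thesis by simp
  qed
qed

lemma Delta_lattice_quotient:
  assumes "k \<ge> 1"
  shows "(ZR 3)\<lparr>carrier := Delta_lattice k\<rparr> Mod Delta_lattice (k + 1) \<cong> integer_mod_group 3"
proof (cases "even k")
  case True
  \<comment> \<open>Here the exponents go from (j, j + 1) to (j + 1, j + 1), so the first coordinate
    is the one to reduce.\<close>
  then obtain j where k: "k = 2 * Suc j"
    using assms by (metis dvdE not_one_le_zero mult_0_right not0_implies_Suc)
  have img: "(\<lambda>u. Poly_Mapping.lookup u 1) ` Delta_lattice k = {x. 3 ^ j dvd x}"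
  proof (intro equalityI subsetI)
    fix y :: int assume "y \<in> {x. 3 ^ j dvd x}"
    then show "y \<in> (\<lambda>u. Poly_Mapping.lookup u 1) ` Delta_lattice k"
      by (intro image_eqI[of _ _ "tri y 0"]) (auto simp: k lookup_tri)
  qed (auto elim!: tri_latticeE simp: k lookup_tri)
  show ?thesis
    by (rule FactGroup_iso_integer_mod_group[where f = "\<lambda>u. Poly_Mapping.lookup u 1" and m = "3 ^ j"])
      (use img in \<open>auto elim!: tri_latticeE intro!: homI simp: k lookup_tri lookup_add mult.commute
        subgroup.subgroup_is_group[OF subgroup_tri_lattice]\<close>)
next
  case False
  then obtain j where k: "k = Suc (2 * j)"
    by (metis oddE Suc_eq_plus1)
  \<comment> \<open>Now the exponents go from (j, j) to (j, j + 1), and \<open>?f\<close> reads off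
    the second coordinate.\<close>
  let ?f = "\<lambda>u :: int \<Rightarrow>\<^sub>0 int. Poly_Mapping.lookup u 1 - Poly_Mapping.lookup u 2"
  have img: "?f ` Delta_lattice k = {x. 3 ^ j dvd x}"
  proof (intro equalityI subsetI)
    fix y :: int assume "y \<in> {x. 3 ^ j dvd x}"
    then show "y \<in> ?f ` Delta_lattice k"
      by (intro image_eqI[of _ _ "tri 0 y"]) (auto simp: k lookup_tri)
  qed (auto elim!: tri_latticeE simp: k lookup_tri)
  show ?thesis
    by (rule FactGroup_iso_integer_mod_group[where f = ?f and m = "3 ^ j"])
      (use img in \<open>auto elim!: tri_latticeE intro!: homI simp: k lookup_tri lookup_add mult.commute
        subgroup.subgroup_is_group[OF subgroup_tri_lattice]\<close>)
qed

theorem proposition6p2: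
  fixes k :: nat
  assumes "k \<ge> 1"
  shows "Delta_pow 3 (2 * k - 1) =
           generate (ZR 3) {frag_cmul (3 ^ (k - 1)) (e 3 1), frag_cmul (3 ^ (k - 1)) (e 3 2)}
       \<and> Delta_pow 3 (2 * k) =
           generate (ZR 3) {frag_cmul (3 ^ (k - 1)) (e 3 1 + e 3 2), frag_cmul (3 ^ k) (e 3 2)}
       \<and> (ZR 3)\<lparr>carrier := Delta_pow 3 k\<rparr> Mod Delta_pow 3 (k + 1) \<cong> integer_mod_group 3"
proof -
  have "(2 * k - 1 - 1) div 2 = k - 1" "(2 * k - 1) div 2 = k - 1"
    using assms by linarith+
  then have "Delta_pow 3 (2 * k - 1) = tri_lattice (3 ^ (k - 1)) (3 ^ (k - 1))"
    and "Delta_pow 3 (2 * k) = tri_lattice (3 ^ (k - 1)) (3 ^ k)"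
    using Delta_pow_3[of "2 * k - 1"] Delta_pow_3[of "2 * k"] assms by simp_all
  then show ?thesis
    using Delta_lattice_quotient[OF assms] assms
    \<comment> \<open>\<open>le_add2\<close> supplies the bound \<open>1 \<le> k + 1\<close> for the
      smaller group in the quotient.\<close>
    by (simp only: tri_lattice_generate_odd tri_lattice_generate_even Delta_pow_3 le_add2)
qed

end
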